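(* Let $n\ge 2$, let $(A,[,\ldots,],\alpha=(\alpha_1,\ldots,\alpha_{n-1}))$ be an $n$-ary Hom-Maltsev algebra over $\mathbf{k}$, and let $\beta\colon A\to A$ be a morphism of $n$-ary Hom-algebras. Then $A_\beta = (A,[,\ldots,]_\beta,\beta\alpha)$, in which $$[x_1,\ldots,x_n]_\beta = \beta([x_1,\ldots,x_n])\quad\text{and}\quad \beta\alpha = (\beta\alpha_1,\ldots,\beta\alpha_{n-1}),$$ is also an $n$-ary Hom-Maltsev algebra. Moreover, if $A$ is multiplicative, then so is $A_\beta$.
   Context: $\mathbf{k}$ is a fixed field of characteristic $0$. For $n\ge 2$, an $n$-ary Hom-algebra $(A,[,\ldots,],\alpha=(\alpha_1,\ldots,\alpha_{n-1}))$ is a $\mathbf{k}$-module $A$ with an $n$-linear map $[,\ldots,]\colon A^{\otimes n}\to A$ and linear maps $\alpha_i\colon A\to A$ (the twisting maps). It is multiplicative if all the twisting maps are equal to one map $\alpha$ and $\alpha([x_1,\ldots,x_n])=[\alpha(x_1),\ldots,\alpha(x_n)]$. A morphism $\beta\colon A\to A$ is a linear map with $\beta([x_1,\ldots,x_n])=[\beta(x_1),\ldots,\beta(x_n)]$ and $\beta\alpha_i=\alpha_i\beta$ for all $i$. The product is anti-symmetric if $[x_1,\ldots,x_n]=\epsilon(\sigma)[x_{\sigma(1)},\ldots,x_{\sigma(n)}]$ for all permutations $\sigma$, with $\epsilon(\sigma)$ the sign. Abbreviations: $x_{i,j}$ stands for the sequence $x_i,\ldots,x_j$; $\alpha_{k,l}(x_{i,j})$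 (with $l-k=j-i$) for $\alpha_k(x_i),\alpha_{k+1}(x_{i+1}),\ldots,\alpha_l(x_j)$; $\alpha^2_{k,l}(x_{i,j})$ for $\alpha_k^2(x_i),\ldots,\alpha_l^2(x_j)$; all are empty if $i>j$. The $n$-ary Hom-Maltsevian of $A$ is $$\begin{aligned} M^n_A(z;x_{2,n};y_{2,n}) &= \sum_{i=2}^n \alpha_1\big([[z,x_{2,n}],\alpha_{2,i-1}(x_{2,i-1}),[x_i,y_{2,n}],\alpha_{i,n-1}(x_{i+1,n})]\big)\\ &\quad+ \sum_{i=2}^n [[\alpha_1(z),\alpha_{2,i-1}(x_{2,i-1}),[x_i,y_{2,n}],\alpha_{i,n-1}(x_{i+1,n})],\alpha^2_{1,n-1}(x_{2,n})]\\ &\quad- [[[z,x_{2,n}],\alpha_{1,n-1}(x_{2,n})],\alpha^2_{1,n-1}(y_{2,n})] + [[[z,y_{2,n}],\alpha_{1,n-1}(x_{2,n})],\alpha^2_{1,n-1}(x_{2,n})]. \end{aligned}$$ An $n$-ary Hom-Maltsev algebra is an $n$-ary Hom-algebra $A$ whose product is anti-symmetric and for which $M^n_A(z;x_{2,n};y_{2,n})=0$ for all $z,x_j,y_k\in A$. *)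

theory Defs
  imports "HOL-Combinatorics.Permutations" Complex_Main
begin

text \<open>
  The argument tuple of an \<open>n\<close>-ary product is a list of length \<open>n\<close>; the values of \<open>\<mu>\<close> on lists of any
  other length are irrelevant. Sequences \<open>x\<close> and twisting maps \<open>\<alpha>\<close> are functions on \<open>nat\<close>, used with the
  1-based indices of the mathematical notation; values of \<open>\<alpha>\<close> outside \<open>{1..n-1}\<close> are irrelevant.
\<close>

definition seg :: "(nat \<Rightarrow> 'v) \<Rightarrow> nat \<Rightarrow> nat \<Rightarrow> 'v list" where
  "seg x i j = map x [i..<Suc j]"

text \<open>
  \<open>twseg \<alpha> k x i j\<close> is \<open>\<alpha>\<^sub>k(x\<^sub>i), \<alpha>\<^sub>k\<^sub>+\<^sub>1(x\<^sub>i\<^sub>+\<^sub>1), \<dots>, \<alpha>\<^sub>l(x\<^sub>j)\<close>; the last index \<open>l\<close> is determined by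
  \<open>l - k = j - i\<close>.
\<close>
definition twseg :: "(nat \<Rightarrow> 'v \<Rightarrow> 'v) \<Rightarrow> nat \<Rightarrow> (nat \<Rightarrow> 'v) \<Rightarrow> nat \<Rightarrow> nat \<Rightarrow> 'v list" where
  "twseg \<alpha> k x i j = map (\<lambda>p. \<alpha> (k + (p - i)) (x p)) [i..<Suc j]"

definition multilinear ::
  "('k::field \<Rightarrow> 'v::ab_group_add \<Rightarrow> 'v) \<Rightarrow> nat \<Rightarrow> ('v list \<Rightarrow> 'v) \<Rightarrow> bool" where
  "multilinear scale n \<mu> \<longleftrightarrow>
     (\<forall>xs i. length xs = n \<and> i < n \<longrightarrow> Vector_Spaces.linear scale scale (\<lambda>v. \<mu> (xs[i := v])))"

definition antisymmetric ::
  "('k::field \<Rightarrow> 'v::ab_group_add \<Rightarrow> 'v) \<Rightarrow> nat \<Rightarrow> ('v list \<Rightarrow> 'v) \<Rightarrow> bool" where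
  "antisymmetric scale n \<mu> \<longleftrightarrow>
     (\<forall>x \<sigma>. \<sigma> permutes {1..n} \<longrightarrow>
        \<mu> (seg x 1 n) = scale (of_int (sign \<sigma>)) (\<mu> (seg (x \<circ> \<sigma>) 1 n)))"

locale nary_hom_algebra = vector_space scale
  for scale :: "'k::field_char_0 \<Rightarrow> 'v::ab_group_add \<Rightarrow> 'v" +
  fixes n :: nat and \<mu> :: "'v list \<Rightarrow> 'v" and \<alpha> :: "nat \<Rightarrow> 'v \<Rightarrow> 'v"
  assumes arity: "n \<ge> 2"
    and product_multilinear: "multilinear scale n \<mu>"
    and twist_linear: "\<And>i. i \<in> {1..n-1} \<Longrightarrow> Vector_Spaces.linear scale scale (\<alpha> i)"

definition multiplicative :: "nat \<Rightarrow> ('v list \<Rightarrow> 'v) \<Rightarrow> (nat \<Rightarrow> 'v \<Rightarrow> 'v) \<Rightarrow> bool" where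
  "multiplicative n \<mu> \<alpha> \<longleftrightarrow>
     (\<exists>a. (\<forall>i\<in>{1..n-1}. \<alpha> i = a) \<and> (\<forall>xs. length xs = n \<longrightarrow> a (\<mu> xs) = \<mu> (map a xs)))"

locale nary_hom_endomorphism = nary_hom_algebra scale n \<mu> \<alpha>
  for scale :: "'k::field_char_0 \<Rightarrow> 'v::ab_group_add \<Rightarrow> 'v"
    and n :: nat and \<mu> :: "'v list \<Rightarrow> 'v" and \<alpha> :: "nat \<Rightarrow> 'v \<Rightarrow> 'v" +
  fixes \<beta> :: "'v \<Rightarrow> 'v"
  assumes endo_linear: "Vector_Spaces.linear scale scale \<beta>"
    and endo_product: "\<And>xs. length xs = n \<Longrightarrow> \<beta> (\<mu> xs) = \<mu> (map \<beta> xs)"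
    and endo_twist: "\<And>i. i \<in> {1..n-1} \<Longrightarrow> \<beta> \<circ> \<alpha> i = \<alpha> i \<circ> \<beta>"

text \<open>Only the values \<open>x 2, \<dots>, x n\<close> and \<open>y 2, \<dots>, y n\<close> are used.\<close>
definition hom_maltsevian ::
  "nat \<Rightarrow> ('v::ab_group_add list \<Rightarrow> 'v) \<Rightarrow> (nat \<Rightarrow> 'v \<Rightarrow> 'v) \<Rightarrow> 'v \<Rightarrow> (nat \<Rightarrow> 'v) \<Rightarrow> (nat \<Rightarrow> 'v) \<Rightarrow> 'v" where
  "hom_maltsevian n \<mu> \<alpha> z x y =
     (let \<alpha>2 = (\<lambda>i. \<alpha> i \<circ> \<alpha> i) in
      (\<Sum>i=2..n. \<alpha> 1 (\<mu> ([\<mu> (z # seg x 2 n)] @ twseg \<alpha> 2 x 2 (i - 1)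
                            @ [\<mu> (x i # seg y 2 n)] @ twseg \<alpha> i x (i + 1) n)))
      + (\<Sum>i=2..n. \<mu> (\<mu> ([\<alpha> 1 z] @ twseg \<alpha> 2 x 2 (i - 1)
                            @ [\<mu> (x i # seg y 2 n)] @ twseg \<alpha> i x (i + 1) n)
                         # twseg \<alpha>2 1 x 2 n))
      - \<mu> (\<mu> (\<mu> (z # seg x 2 n) # twseg \<alpha> 1 x 2 n) # twseg \<alpha>2 1 y 2 n)
      + \<mu> (\<mu> (\<mu> (z # seg y 2 n) # twseg \<alpha> 1 x 2 n) # twseg \<alpha>2 1 x 2 n))"

locale nary_hom_maltsev_algebra = nary_hom_algebra scale n \<mu> \<alpha>
  for scale :: "'k::field_char_0 \<Rightarrow> 'v::ab_group_add \<Rightarrow> 'v"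
    and n :: nat and \<mu> :: "'v list \<Rightarrow> 'v" and \<alpha> :: "nat \<Rightarrow> 'v \<Rightarrow> 'v" +
  assumes product_antisymmetric: "antisymmetric scale n \<mu>"
    and hom_maltsevian_zero: "\<And>z x y. hom_maltsevian n \<mu> \<alpha> z x y = 0"

end

theory Submission
  imports Defs
begin

text \<open>
  In each summand of the Hom-Maltsevian, every path from the outside to a variable crosses exactly
  three operations, each of them either the product or a twisting map: an entry that passes through
  fewer brackets carries correspondingly more twisting maps. Composing the product and the twisting
  maps with \<open>\<beta>\<close> therefore inserts exactly three copies of \<open>\<beta>\<close> along each path, and since \<open>\<beta>\<close> commutes
  with the product and with the twisting maps, these copies can all be moved to the front. As \<open>\<beta>\<close> is
  additive, the Hom-Maltsevian of the twisted algebra is \<open>\<beta>\<^sup>3\<close> applied to that of the original one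
  (\<open>hom_maltsevian_twist\<close>), so it vanishes as soon as the latter does. Multilinearity and
  antisymmetry survive composition with a linear map, and multiplicativity is again a matter of
  commuting \<open>\<beta>\<close> past the product and the common twisting map.
\<close>

lemma map_twseg: "map f (twseg \<alpha> k x i j) = twseg (\<lambda>m. f \<circ> \<alpha> m) k x i j"
  by (simp add: twseg_def)

lemma multilinear_compose_linear:
  assumes "multilinear scale n \<mu>" and "Vector_Spaces.linear scale scale f"
  shows "multilinear scale n (\<lambda>xs. f (\<mu> xs))"
  using assms Vector_Spaces.linear_compose[of scale scale _ scale f]
  unfolding multilinear_def by (fastforce simp: o_def)

lemma antisymmetric_compose_linear:
  assumes "antisymmetric scale n \<mu>" and "Vector_Spaces.linear scale scale f"
  shows "antisymmetric scale n (\<lambda>xs. f (\<mu> xs))"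
proof -
  interpret f: Vector_Spaces.linear scale scale f by (fact assms(2))
  show ?thesis
    unfolding antisymmetric_def
  proof (intro allI impI)
    fix x and \<sigma> :: "nat \<Rightarrow> nat"
    assume "\<sigma> permutes {1..n}"
    then have "\<mu> (seg x 1 n) = scale (of_int (sign \<sigma>)) (\<mu> (seg (x \<circ> \<sigma>) 1 n))"
      using assms(1) unfolding antisymmetric_def by blast
    then show "f (\<mu> (seg x 1 n)) = scale (of_int (sign \<sigma>)) (f (\<mu> (seg (x \<circ> \<sigma>) 1 n)))"
      by (simp add: f.scale)
  qed
qed

context nary_hom_endomorphism
begin

lemma endo_twist_apply: "i \<in> {1..n-1} \<Longrightarrow> \<alpha> i (\<beta> v) = \<beta> (\<alpha> i v)"
  using endo_twist[of i] by (metis comp_apply)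

lemma twisted_nary_hom_algebra:
  "nary_hom_algebra scale n (\<lambda>xs. \<beta> (\<mu> xs)) (\<lambda>i. \<beta> \<circ> \<alpha> i)"
proof (intro nary_hom_algebra.intro nary_hom_algebra_axioms.intro)
  show "vector_space scale" by (fact vector_space_axioms)
  show "multilinear scale n (\<lambda>xs. \<beta> (\<mu> xs))"
    by (rule multilinear_compose_linear[OF product_multilinear endo_linear])
  show "Vector_Spaces.linear scale scale (\<beta> \<circ> \<alpha> i)" if "i \<in> {1..n-1}" for i
    by (rule Vector_Spaces.linear_compose[OF twist_linear[OF that] endo_linear])
qed (fact arity)

lemma twseg_twist_square:
  "twseg (\<lambda>i. (\<beta> \<circ> \<alpha> i) \<circ> (\<beta> \<circ> \<alpha> i)) 1 x 2 n = map \<beta> (map \<beta> (twseg (\<lambda>i. \<alpha> i \<circ> \<alpha> i) 1 x 2 n))"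
  by (auto simp: twseg_def endo_twist_apply)

text \<open>
  Working outwards, the entries below the middle operation share one factor \<open>\<beta>\<close> and the entries
  below the outermost operation share two. Pulling these out in turn, next to the copy of \<open>\<beta>\<close> that
  the outermost operation itself brings, collects all three in front of the summand.
\<close>
lemma hom_maltsevian_twist:
  "hom_maltsevian n (\<lambda>xs. \<beta> (\<mu> xs)) (\<lambda>i. \<beta> \<circ> \<alpha> i) z x y = \<beta> (\<beta> (\<beta> (hom_maltsevian n \<mu> \<alpha> z x y)))"
proof -
  interpret \<beta>: Vector_Spaces.linear scale scale \<beta> by (fact endo_linear)
  let ?sq = "\<lambda>i. \<alpha> i \<circ> \<alpha> i"
  let ?mid = "\<lambda>i. [\<mu> (x i # seg y 2 n)]"
  let ?row = "\<lambda>u i. u # twseg \<alpha> 2 x 2 (i - 1) @ ?mid i @ twseg \<alpha> i x (i + 1) n"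
  have one: "1 \<in> {1..n-1}" using arity by auto
  have len_row: "length (?row u i) = n" if "i \<in> {2..n}" for u i
    using that by (auto simp: twseg_def)
  have len: "length (v # twseg \<gamma> k w 2 n) = n" for v \<gamma> k w
    using arity by (simp add: twseg_def)
  have row: "\<beta> (\<mu> (\<beta> u # twseg (\<lambda>i. \<beta> \<circ> \<alpha> i) 2 x 2 (i - 1) @ [\<beta> (\<mu> (x i # seg y 2 n))]
                     @ twseg (\<lambda>i. \<beta> \<circ> \<alpha> i) i x (i + 1) n)) = \<beta> (\<beta> (\<mu> (?row u i)))"
    if "i \<in> {2..n}" for u i
    using endo_product[OF len_row[OF that]] by (simp add: map_twseg)
  have mid: "\<mu> (\<beta> u # twseg (\<lambda>i. \<beta> \<circ> \<alpha> i) 1 w 2 n) = \<beta> (\<mu> (u # twseg \<alpha> 1 w 2 n))" for u w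
    using endo_product[OF len] by (simp add: map_twseg)
  have outer: "\<mu> (\<beta> (\<beta> u) # twseg (\<lambda>i. (\<beta> \<circ> \<alpha> i) \<circ> (\<beta> \<circ> \<alpha> i)) 1 w 2 n)
                 = \<beta> (\<beta> (\<mu> (u # twseg ?sq 1 w 2 n)))" for u w
  proof -
    have "\<mu> (\<beta> (\<beta> u) # twseg (\<lambda>i. (\<beta> \<circ> \<alpha> i) \<circ> (\<beta> \<circ> \<alpha> i)) 1 w 2 n)
            = \<mu> (map \<beta> (map \<beta> (u # twseg ?sq 1 w 2 n)))"
      by (simp only: twseg_twist_square list.map)
    also have "\<dots> = \<beta> (\<beta> (\<mu> (u # twseg ?sq 1 w 2 n)))"
      using len by (metis endo_product length_map)
    finally show ?thesis .
  qed
  have sum1: "(\<Sum>i=2..n. (\<beta> \<circ> \<alpha> 1) (\<beta> (\<mu> ([\<beta> (\<mu> (z # seg x 2 n))] @ twseg (\<lambda>i. \<beta> \<circ> \<alpha> i) 2 x 2 (i - 1)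
                  @ [\<beta> (\<mu> (x i # seg y 2 n))] @ twseg (\<lambda>i. \<beta> \<circ> \<alpha> i) i x (i + 1) n))))
      = \<beta> (\<beta> (\<beta> (\<Sum>i=2..n. \<alpha> 1 (\<mu> ([\<mu> (z # seg x 2 n)] @ twseg \<alpha> 2 x 2 (i - 1)
                  @ [\<mu> (x i # seg y 2 n)] @ twseg \<alpha> i x (i + 1) n)))))"
    unfolding \<beta>.sum
  proof (intro sum.cong refl, goal_cases)
    case (1 i)
    then show ?case
      using row[of i "\<mu> (z # seg x 2 n)"] by (simp add: endo_twist_apply[OF one, simplified])
  qed
  have sum2: "(\<Sum>i=2..n. \<beta> (\<mu> (\<beta> (\<mu> ([(\<beta> \<circ> \<alpha> 1) z] @ twseg (\<lambda>i. \<beta> \<circ> \<alpha> i) 2 x 2 (i - 1)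
                  @ [\<beta> (\<mu> (x i # seg y 2 n))] @ twseg (\<lambda>i. \<beta> \<circ> \<alpha> i) i x (i + 1) n))
                  # twseg (\<lambda>i. (\<beta> \<circ> \<alpha> i) \<circ> (\<beta> \<circ> \<alpha> i)) 1 x 2 n)))
      = \<beta> (\<beta> (\<beta> (\<Sum>i=2..n. \<mu> (\<mu> ([\<alpha> 1 z] @ twseg \<alpha> 2 x 2 (i - 1)
                  @ [\<mu> (x i # seg y 2 n)] @ twseg \<alpha> i x (i + 1) n) # twseg ?sq 1 x 2 n))))"
    unfolding \<beta>.sum
  proof (intro sum.cong refl, goal_cases)
    case (1 i)
    then show ?case
      using row[of i "\<alpha> 1 z"] outer[of "\<mu> (?row (\<alpha> 1 z) i)" x] by simp
  qed
  have iterated: "\<beta> (\<mu> (\<beta> (\<mu> (\<beta> (\<mu> (z # seg v 2 n)) # twseg (\<lambda>i. \<beta> \<circ> \<alpha> i) 1 x 2 n))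
                     # twseg (\<lambda>i. (\<beta> \<circ> \<alpha> i) \<circ> (\<beta> \<circ> \<alpha> i)) 1 w 2 n))
      = \<beta> (\<beta> (\<beta> (\<mu> (\<mu> (\<mu> (z # seg v 2 n) # twseg \<alpha> 1 x 2 n) # twseg ?sq 1 w 2 n))))" for v w
    by (simp only: mid outer)
  show ?thesis
    unfolding hom_maltsevian_def Let_def sum1 sum2 iterated
    by (simp only: \<beta>.add \<beta>.diff)
qed

lemma multiplicative_twist:
  assumes "multiplicative n \<mu> \<alpha>"
  shows "multiplicative n (\<lambda>xs. \<beta> (\<mu> xs)) (\<lambda>i. \<beta> \<circ> \<alpha> i)"
proof -
  obtain a where a: "\<And>i. i \<in> {1..n-1} \<Longrightarrow> \<alpha> i = a"
    and mult: "\<And>xs. length xs = n \<Longrightarrow> a (\<mu> xs) = \<mu> (map a xs)"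
    using assms unfolding multiplicative_def by blast
  \<comment> \<open>Since \<open>n \<ge> 2\<close>, at least one twisting map exists, so \<open>a\<close> itself commutes with \<open>\<beta>\<close>.\<close>
  have comm: "a (\<beta> v) = \<beta> (a v)" for v
    using endo_twist_apply[of 1 v] a[of 1] arity by auto
  have "(\<beta> \<circ> a) (\<beta> (\<mu> xs)) = \<beta> (\<mu> (map (\<beta> \<circ> a) xs))" if "length xs = n" for xs
    using that endo_product[of "map a xs"] by (simp add: comm mult)
  then show ?thesis
    unfolding multiplicative_def using a by (intro exI[of _ "\<beta> \<circ> a"]) auto
qed

end

theorem theorem5p4:
  fixes scale :: "'k::field_char_0 \<Rightarrow> 'v::ab_group_add \<Rightarrow> 'v"
    and n :: nat
    and \<mu> :: "'v list \<Rightarrow> 'v"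
    and \<alpha> :: "nat \<Rightarrow> 'v \<Rightarrow> 'v"
    and \<beta> :: "'v \<Rightarrow> 'v"
  assumes "n \<ge> 2"
    and "nary_hom_maltsev_algebra scale n \<mu> \<alpha>"
    and "nary_hom_endomorphism scale n \<mu> \<alpha> \<beta>"
  shows "nary_hom_maltsev_algebra scale n (\<lambda>xs. \<beta> (\<mu> xs)) (\<lambda>i. \<beta> \<circ> \<alpha> i) \<and>
         (multiplicative n \<mu> \<alpha> \<longrightarrow>
            multiplicative n (\<lambda>xs. \<beta> (\<mu> xs)) (\<lambda>i. \<beta> \<circ> \<alpha> i))"
proof -
  interpret A: nary_hom_maltsev_algebra scale n \<mu> \<alpha> by (fact assms(2))
  interpret E: nary_hom_endomorphism scale n \<mu> \<alpha> \<beta> by (fact assms(3))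
  interpret \<beta>: Vector_Spaces.linear scale scale \<beta> by (fact E.endo_linear)
  interpret T: nary_hom_algebra scale n "\<lambda>xs. \<beta> (\<mu> xs)" "\<lambda>i. \<beta> \<circ> \<alpha> i"
    by (fact E.twisted_nary_hom_algebra)
  have "nary_hom_maltsev_algebra scale n (\<lambda>xs. \<beta> (\<mu> xs)) (\<lambda>i. \<beta> \<circ> \<alpha> i)"
  proof
    show "antisymmetric scale n (\<lambda>xs. \<beta> (\<mu> xs))"
      by (rule antisymmetric_compose_linear[OF A.product_antisymmetric E.endo_linear])
    show "hom_maltsevian n (\<lambda>xs. \<beta> (\<mu> xs)) (\<lambda>i. \<beta> \<circ> \<alpha> i) z x y = 0" for z x y
      by (simp only: E.hom_maltsevian_twist A.hom_maltsevian_zero \<beta>.zero)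
  qed
  then show ?thesis
    using E.multiplicative_twist by blast
qed

end
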